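(* Let $X$ be a locally convex space over $\mathbb R$ and let $d$ be a translation-invariant metric on $X$ generating the topology of $X$. For any sequence $(B_n)_{n\in\mathbb N}$ of nowhere dense bounded convex sets in $X$ and any sequence $(\varepsilon_n)_{n\in\mathbb N}$ of positive real numbers with $\lim_{n\to\infty}\varepsilon_n=0$, the set $$B=\{x\in X:\ \forall n\in\mathbb N\ \ \exists y\in B_n\ \ d(x,y)<\varepsilon_n\}$$ is nowhere dense in $X$.
   Context: A locally convex space means a locally convex linear topological space over the field of real numbers. The metric $d$ is translation-invariant if $d(x+z,y+z)=d(x,y)$ for all $x,y,z\in X$. A subset $S$ of a linear topological space $X$ is bounded if for any neighborhood $U$ of zero in $X$ there exists a positive real number $r$ such that $S\subset r\cdot U$ (boundedness in this sense, not in the sense of the metric $d$). A subset of a topological space is nowhere dense if its closure has empty interior. *)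

theory Defs
  imports "HOL-Analysis.Analysis"
begin

text \<open>Real topological vector spaces. Hausdorffness is not part of the class.\<close>

class topological_real_vector = real_vector + topological_ab_group_add +
  assumes tendsto_scaleR_Pair:
    "LIM p (nhds c \<times>\<^sub>F nhds a). fst p *\<^sub>R snd p :> nhds (c *\<^sub>R a)"

text \<open>Class axioms cannot mention \<^const>\<open>convex\<close> and \<^const>\<open>interior\<close> of the class type,
  so the axiom below spells them out.\<close>

class locally_convex_space = topological_real_vector +
  assumes locally_convex_at_0_unfolded:
    "open U \<Longrightarrow> 0 \<in> U \<Longrightarrow>
      \<exists>V. (\<forall>x\<in>V. \<forall>y\<in>V. \<forall>u\<ge>0. \<forall>v\<ge>0. u + v = 1 \<longrightarrow> u *\<^sub>R x + v *\<^sub>R y \<in> V) \<and>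
        (\<exists>W. open W \<and> 0 \<in> W \<and> W \<subseteq> V) \<and> V \<subseteq> U"

lemma locally_convex_at_0:
  fixes U :: "'a::locally_convex_space set"
  assumes "open U" "0 \<in> U"
  shows "\<exists>V. convex V \<and> 0 \<in> interior V \<and> V \<subseteq> U"
  using locally_convex_at_0_unfolded[OF assms]
  unfolding convex_def interior_def by blast

instance real_normed_vector \<subseteq> locally_convex_space
proof
  fix c :: real and a :: 'a
  show "LIM p (nhds c \<times>\<^sub>F nhds a). fst p *\<^sub>R snd p :> nhds (c *\<^sub>R a)"
    by (intro tendsto_scaleR filterlim_fst filterlim_snd)
next
  fix U :: "'a set"
  assume "open U" "0 \<in> U"
  then obtain e where e: "e > 0" "ball 0 e \<subseteq> U"
    using open_contains_ball by blast
  have "\<forall>x\<in>ball 0 e. \<forall>y\<in>ball 0 e. \<forall>u\<ge>0. \<forall>v\<ge>0. u + v = 1 \<longrightarrow> u *\<^sub>R x + v *\<^sub>R y \<in> ball (0::'a) e"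
    using convex_ball[of "0::'a" e] unfolding convex_def .
  moreover have "\<exists>W. open W \<and> 0 \<in> W \<and> W \<subseteq> ball (0::'a) e"
    using e(1) by (intro exI[of _ "ball 0 e"]) simp
  ultimately show "\<exists>V. (\<forall>x\<in>V. \<forall>y\<in>V. \<forall>u\<ge>0. \<forall>v\<ge>0. u + v = 1 \<longrightarrow> u *\<^sub>R x + v *\<^sub>R y \<in> V) \<and>
      (\<exists>W. open W \<and> 0 \<in> W \<and> W \<subseteq> V) \<and> V \<subseteq> U"
    using e(2) by blast
qed

text \<open>Boundedness with respect to the linear topology; the library's
  \<^const>\<open>bounded\<close> refers to a metric instead.\<close>

definition tvs_bounded :: "'a::topological_real_vector set \<Rightarrow> bool"
  where "tvs_bounded S \<longleftrightarrow> (\<forall>U. 0 \<in> interior U \<longrightarrow> (\<exists>r::real. r > 0 \<and> S \<subseteq> (*\<^sub>R) r ` U))"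

definition nowhere_dense :: "'a::topological_space set \<Rightarrow> bool"
  where "nowhere_dense S \<longleftrightarrow> interior (closure S) = {}"

definition translation_invariant :: "('a::plus \<Rightarrow> 'a \<Rightarrow> real) \<Rightarrow> bool"
  where "translation_invariant d \<longleftrightarrow> (\<forall>x y z. d (x + z) (y + z) = d x y)"

end

theory Submission
  imports Defs
begin

text \<open>The set in question is bounded, being contained in \<open>B\<^sub>n + U\<close> for every neighbourhood \<open>U\<close>
  of zero and a suitable \<open>n\<close>. If its closure contains a ball of radius \<open>2\<delta>\<close> about \<open>x\<^sub>0\<close>, then this
  ball is bounded, and for large \<open>n\<close> it lies in \<open>B\<^sub>n + W\<close>, where \<open>W\<close> is the ball of radius \<open>\<delta>\<close>
  about zero. So \<open>x\<^sub>0 + W + W \<subseteq> B\<^sub>n + W\<close>, and Radstrom's cancellation law gives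
  \<open>x\<^sub>0 + W \<subseteq> closure B\<^sub>n\<close>.\<close>

lemma tvs_bounded_subset: "tvs_bounded T \<Longrightarrow> S \<subseteq> T \<Longrightarrow> tvs_bounded S"
  unfolding tvs_bounded_def by (meson subset_trans)

text \<open>A convex \<open>V\<close> containing zero is closed under multiplication by factors in
  [0, 1]. If \<open>C\<close> lies in \<open>r\<close> times \<open>V\<close>, then once
  \<open>n\<close> is at least \<open>r\<close> the factor \<open>r / (n + 1)\<close> is at most 1,
  so the scaled points stay in \<open>V\<close>.\<close>

lemma tvs_bounded_scaled_sequence_tendsto_0:
  fixes C :: "'a::locally_convex_space set"
  assumes "tvs_bounded C" and c: "\<And>n. c n \<in> C"
  shows "(\<lambda>n. (1 / real (Suc n)) *\<^sub>R c n) \<longlonglongrightarrow> 0"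
proof (rule topological_tendstoI)
  fix U :: "'a set" assume "open U" "0 \<in> U"
  then obtain V where V: "convex V" "0 \<in> interior V" "V \<subseteq> U"
    using locally_convex_at_0 by blast
  obtain r where r: "r > 0" "C \<subseteq> (*\<^sub>R) r ` V"
    using assms(1) V(2) unfolding tvs_bounded_def by blast
  have "0 \<in> V" using V(2) interior_subset by blast
  obtain N where N: "real N \<ge> r" using real_arch_simple by blast
  show "\<forall>\<^sub>F n in sequentially. (1 / real (Suc n)) *\<^sub>R c n \<in> U"
    unfolding eventually_sequentially
  proof (intro exI allI impI)
    fix n assume "N \<le> n"
    obtain v where v: "v \<in> V" "c n = r *\<^sub>R v" using r(2) c by blast
    have t: "r / real (Suc n) \<ge> 0" "r / real (Suc n) \<le> 1"
      using r(1) N \<open>N \<le> n\<close> by (auto simp: field_simps)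
    have "(1 - r / real (Suc n)) *\<^sub>R 0 + (r / real (Suc n)) *\<^sub>R v \<in> V"
      using convexD_alt[OF V(1) \<open>0 \<in> V\<close> v(1) t] by simp
    then show "(1 / real (Suc n)) *\<^sub>R c n \<in> U" using V(3) v(2) by auto
  qed
qed

text \<open>Iterating the inclusion of \<open>a + C\<close> in \<open>D + C\<close> puts
  \<open>(n + 1) a + c0\<close> into \<open>(n + 1) D + C\<close>, since convexity merges the
  summands from \<open>D\<close> into one multiple of a point of \<open>D\<close>. After division by
  \<open>n + 1\<close> the terms from the bounded set \<open>C\<close> vanish in the limit, leaving
  \<open>a\<close> as a limit of points of \<open>D\<close>.\<close>

lemma radstrom_cancellation:
  fixes C D :: "'a::locally_convex_space set"
  assumes "tvs_bounded C" "C \<noteq> {}" "convex D"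
    and step: "\<And>c. c \<in> C \<Longrightarrow> \<exists>y\<in>D. a + c - y \<in> C"
  shows "a \<in> closure D"
proof -
  obtain c0 where c0: "c0 \<in> C" using assms(2) by blast
  have "\<exists>y\<in>D. \<exists>c\<in>C. real (Suc n) *\<^sub>R a + c0 = real (Suc n) *\<^sub>R y + c" for n
  proof (induction n)
    case 0
    from step[OF c0] obtain y where "y \<in> D" "a + c0 - y \<in> C" by blast
    then show ?case by (intro bexI[of _ y] bexI[of _ "a + c0 - y"]) auto
  next
    case (Suc n)
    define m where "m = real (Suc n)"
    have m: "m > 0" "real (Suc (Suc n)) = m + 1" by (auto simp: m_def)
    from Suc obtain y c where yc: "y \<in> D" "c \<in> C" "m *\<^sub>R a + c0 = m *\<^sub>R y + c"
      unfolding m_def by blast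
    from step[OF yc(2)] obtain z where z: "z \<in> D" "a + c - z \<in> C" by blast
    \<comment> \<open>The weights make \<open>(m + 1) w\<close> equal to \<open>m y + z\<close>, so
      the new summand \<open>z\<close> is absorbed into a single point of \<open>D\<close>.\<close>
    define w where "w = (m / (m + 1)) *\<^sub>R y + (1 / (m + 1)) *\<^sub>R z"
    have "w \<in> D" unfolding w_def
      using m(1) by (intro convexD[OF assms(3) yc(1) z(1)]) (auto simp: field_simps)
    moreover have "(m + 1) *\<^sub>R w = m *\<^sub>R y + z"
      using m(1) by (simp add: w_def scaleR_add_right)
    then have "(m + 1) *\<^sub>R a + c0 = (m + 1) *\<^sub>R w + (a + c - z)"
      using yc(3) by (simp add: scaleR_add_left algebra_simps)
    ultimately show ?case unfolding m(2) using z(2) by blast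
  qed
  then obtain y c where y: "\<And>n. y n \<in> D" and c: "\<And>n. c n \<in> C"
    and eq: "\<And>n. real (Suc n) *\<^sub>R a + c0 = real (Suc n) *\<^sub>R y n + c n"
    by metis
  have y_eq: "y n = a + (1 / real (Suc n)) *\<^sub>R c0 - (1 / real (Suc n)) *\<^sub>R c n" for n
  proof -
    have "(1 / real (Suc n)) *\<^sub>R (real (Suc n) *\<^sub>R a + c0)
        = (1 / real (Suc n)) *\<^sub>R (real (Suc n) *\<^sub>R y n + c n)"
      using eq by simp
    then show ?thesis by (simp add: scaleR_add_right algebra_simps del: of_nat_Suc)
  qed
  have "y \<longlonglongrightarrow> a + 0 - 0" unfolding y_eq[abs_def]
    by (intro tendsto_intros tvs_bounded_scaled_sequence_tendsto_0[OF assms(1)] c0 c)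
  then have "y \<longlonglongrightarrow> a" by simp
  then show ?thesis
    using y closure_subset[of D]
    by (intro Lim_in_closed_set[of "closure D" y sequentially])
      (auto intro!: always_eventually)
qed

lemma mtopology_euclidean_openD:
  fixes d :: "'a::topological_space \<Rightarrow> 'a \<Rightarrow> real"
  assumes "Metric_space UNIV d" "Metric_space.mtopology UNIV d = euclidean" "open U" "x \<in> U"
  shows "\<exists>r>0. Metric_space.mball UNIV d x r \<subseteq> U"
  using assms Metric_space.openin_mtopology[OF assms(1), of U] by auto

lemma mtopology_euclidean_closureD:
  fixes d :: "'a::topological_space \<Rightarrow> 'a \<Rightarrow> real"
  assumes "Metric_space UNIV d" "Metric_space.mtopology UNIV d = euclidean" "x \<in> closure S" "r > 0"
  shows "\<exists>y\<in>S. d x y < r"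
proof -
  interpret Metric_space UNIV d by (rule assms(1))
  have "open (mball x r)" using openin_mball[of x r] assms(2) by simp
  then have "mball x r \<inter> S \<noteq> {}"
    using assms open_Int_closure_eq_empty[of "mball x r" S] by force
  then show ?thesis by auto
qed

theorem theorem3:
  fixes d :: "'a::locally_convex_space \<Rightarrow> 'a \<Rightarrow> real"
    and B :: "nat \<Rightarrow> 'a set"
    and \<epsilon> :: "nat \<Rightarrow> real"
  assumes metric: "Metric_space UNIV d"
    and generates: "Metric_space.mtopology UNIV d = (euclidean :: 'a topology)"
    and invariant: "translation_invariant d"
    and nowhere_dense_B: "\<And>n. nowhere_dense (B n)"
    and bounded_B: "\<And>n. tvs_bounded (B n)"
    and convex_B: "\<And>n. convex (B n)"
    and eps_pos: "\<And>n. \<epsilon> n > 0"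
    and eps_lim: "\<epsilon> \<longlonglongrightarrow> 0"
  shows "nowhere_dense {x. \<forall>n. \<exists>y \<in> B n. d x y < \<epsilon> n}"
proof -
  interpret Metric_space UNIV d by (rule metric)
  define S where "S = {x. \<forall>n. \<exists>y \<in> B n. d x y < \<epsilon> n}"
  have translate: "d (x + z) (y + z) = d x y" for x y z
    using invariant unfolding translation_invariant_def by blast
  have d_diff: "d 0 (x - y) = d x y" for x y
    using translate[of 0 y "x - y"] commute by simp
  \<comment> \<open>A single \<open>n\<close> serves all of \<open>closure S\<close>: half of
    \<delta> pays for passing from the closure to \<open>S\<close>, the other half for passing from
    \<open>S\<close> to \<open>B n\<close>.\<close>
  have approx: "\<exists>n. \<forall>z\<in>closure S. \<exists>y\<in>B n. d z y < \<delta>" if "\<delta> > 0" for \<delta>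
  proof -
    from that have "\<forall>\<^sub>F n in sequentially. \<epsilon> n < \<delta> / 2"
      using order_tendstoD(2)[OF eps_lim, of "\<delta> / 2"] by simp
    then obtain n where n: "\<epsilon> n < \<delta> / 2"
      using eventually_happens' sequentially_bot by blast
    have "\<exists>y\<in>B n. d z y < \<delta>" if z: "z \<in> closure S" for z
    proof -
      obtain x where x: "x \<in> S" "d z x < \<delta> / 2"
        using mtopology_euclidean_closureD[OF metric generates z, of "\<delta> / 2"] \<open>\<delta> > 0\<close> by auto
      then obtain y where "y \<in> B n" "d x y < \<epsilon> n" unfolding S_def by blast
      then show ?thesis using triangle[of z x y] x(2) n by (intro bexI[of _ y]) auto
    qed
    then show ?thesis by blast
  qed
  have bounded: "tvs_bounded (closure S)"
    unfolding tvs_bounded_def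
  proof (intro allI impI)
    fix U :: "'a set" assume "0 \<in> interior U"
    then obtain V where V: "convex V" "0 \<in> interior V" "V \<subseteq> U"
      using locally_convex_at_0[of "interior U"] interior_subset by blast
    obtain \<delta> where \<delta>: "\<delta> > 0" "mball 0 \<delta> \<subseteq> V"
      using mtopology_euclidean_openD[OF metric generates open_interior V(2)] interior_subset by blast
    obtain n where n: "\<And>z. z \<in> closure S \<Longrightarrow> \<exists>y\<in>B n. d z y < \<delta>"
      using approx[OF \<delta>(1)] by blast
    obtain r where r: "r > 0" "B n \<subseteq> (*\<^sub>R) r ` V"
      using bounded_B[of n] V(2) unfolding tvs_bounded_def by blast
    \<comment> \<open>Each point is the sum of a point of \<open>r V\<close> and a point of
      \<open>V\<close>, and convexity puts such sums into \<open>(r + 1) V\<close>.\<close>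
    have "closure S \<subseteq> (*\<^sub>R) (r + 1) ` U"
    proof
      fix z assume "z \<in> closure S"
      then obtain y where y: "y \<in> B n" "d z y < \<delta>" using n by blast
      obtain v where v: "v \<in> V" "y = r *\<^sub>R v" using r(2) y(1) by blast
      have zy: "z - y \<in> V" using \<delta>(2) y(2) d_diff by auto
      have "(r / (r + 1)) *\<^sub>R v + (1 / (r + 1)) *\<^sub>R (z - y) \<in> V" (is "?w \<in> V")
        using r(1) by (intro convexD[OF V(1) v(1) zy]) (auto simp: field_simps)
      moreover have "z = (r + 1) *\<^sub>R ?w"
        using r(1) v(2) by (simp add: scaleR_add_right)
      ultimately show "z \<in> (*\<^sub>R) (r + 1) ` U" using V(3) by blast
    qed
    then show "\<exists>r>0. closure S \<subseteq> (*\<^sub>R) r ` U"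
      using r(1) by (intro exI[of _ "r + 1"]) simp
  qed
  have "interior (closure S) = {}"
  proof (rule ccontr)
    assume "interior (closure S) \<noteq> {}"
    then obtain x0 where "x0 \<in> interior (closure S)" by blast
    then obtain \<rho> where \<rho>: "\<rho> > 0" "mball x0 \<rho> \<subseteq> closure S"
      using mtopology_euclidean_openD[OF metric generates open_interior] interior_subset by blast
    \<comment> \<open>Halving leaves room for two displacements: for \<open>a\<close> and
      \<open>c\<close> in the \<delta>-ball about \<open>x0\<close>, the point
      \<open>a + c - x0\<close> is within \<rho> of \<open>x0\<close>, hence in
      \<open>closure S\<close>.\<close>
    define \<delta> where "\<delta> = \<rho> / 2"
    have \<delta>: "\<delta> > 0" "\<delta> + \<delta> = \<rho>" using \<rho>(1) by (auto simp: \<delta>_def)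
    obtain n where n: "\<And>z. z \<in> closure S \<Longrightarrow> \<exists>y\<in>B n. d z y < \<delta>"
      using approx[OF \<delta>(1)] by blast
    have "mball x0 \<delta> \<subseteq> closure (B n)"
    proof
      fix a assume a: "a \<in> mball x0 \<delta>"
      \<comment> \<open>Cancellation is applied with the ball about \<open>x0\<close> itself as
        \<open>C\<close>, which amounts to shifting the inclusion for the ball about zero by
        \<open>x0\<close>.\<close>
      show "a \<in> closure (B n)"
      proof (rule radstrom_cancellation)
        show "tvs_bounded (mball x0 \<delta>)"
          using \<rho>(2) \<delta> by (intro tvs_bounded_subset[OF bounded]) auto
        show "mball x0 \<delta> \<noteq> {}" "convex (B n)" using a convex_B by auto
        fix c assume c: "c \<in> mball x0 \<delta>"
        have "d a (a + c - x0) = d x0 c"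
          using translate[of x0 "a - x0" c] by (simp add: algebra_simps)
        then have "d x0 (a + c - x0) < \<rho>"
          using triangle[of x0 a "a + c - x0"] a c \<delta>(2) by auto
        then obtain y where y: "y \<in> B n" "d (a + c - x0) y < \<delta>"
          using n \<rho>(2) by (meson UNIV_I in_mball subsetD)
        \<comment> \<open>Both sides are the distance from zero to \<open>a + c - x0 - y\<close>;
          this turns closeness to \<open>y\<close> into membership in the ball about
          \<open>x0\<close>.\<close>
        have "d x0 (a + c - y) = d (a + c - x0) y"
          using d_diff[of "a + c - x0" y] translate[of 0 x0 "a + c - x0 - y"]
          by (simp add: algebra_simps)
        then show "\<exists>y\<in>B n. a + c - y \<in> mball x0 \<delta>"
          using y by (intro bexI[of _ y]) auto
      qed
    qed
    moreover have "open (mball x0 \<delta>)" using openin_mball[of x0 \<delta>] generates by simp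
    ultimately have "mball x0 \<delta> \<subseteq> interior (closure (B n))" by (rule interior_maximal)
    then show False
      using nowhere_dense_B[of n] \<delta>(1) unfolding nowhere_dense_def by auto
  qed
  then show ?thesis unfolding nowhere_dense_def S_def .
qed

end
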